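(* Every Pareto–Lévy copula $\Gamma:[0,\infty]^2\setminus\{(0,0)\}\to[0,\infty)$ has the following properties. (i) (Lipschitz continuity) For all $\mathbf u,\mathbf v\in[0,\infty]^2\setminus\{(0,0)\}$, $$|\Gamma(\mathbf u)-\Gamma(\mathbf v)|\le\left|\frac1{u_1}-\frac1{v_1}\right|+\left|\frac1{u_2}-\frac1{v_2}\right|.$$ (ii) (Monotonicity) $\Gamma$ is 2-increasing and the functions $\Gamma(u,\cdot)$ and $\Gamma(\cdot,u)$ are nonincreasing for each fixed $u\ge0$. (iii) (Fréchet–Hoeffding bounds) $\Gamma_\perp\le\Gamma\le\Gamma_\Vert$, where $\Gamma_\Vert(\mathbf u)=(u_1\vee u_2)^{-1}$ and $\Gamma_\perp(\mathbf u)=u_1^{-1}1_{\{u_2=0\}}+u_2^{-1}1_{\{u_1=0\}}$ denote the Pareto–Lévy copulas corresponding to perfect positive dependence and to independence, respectively. (iv) (Partial derivatives) $\dot\Gamma_1(u_1,0)=-u_1^{-2}$ and $\dot\Gamma_1(u_1,\infty)=0$ for $u_1\in(0,\infty)$. For fixed $u_2\in(0,\infty)$, the partial derivative $\dot\Gamma_1(u_1,u_2)$ exists for almost all $u_1\in(0,\infty)$, and for such $u_1$ and $u_2$ we have $$0\ge\dot\Gamma_1(u_1,u_2)\ge-u_1^{-2}.$$ Furthermore, the mapping $u_2\mapsto\dot\Gamma_1(u_1,u_2)$ is defined and nondecreasing almost everywhere. Analogously, $\dot\Gamma_2(0,u_2)=-u_2^{-2}$ and $\dot\Gamma_2(\infty,u_2)=0$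 for $u_2\in(0,\infty)$; for fixed $u_1\in(0,\infty)$ the partial derivative $\dot\Gamma_2(u_1,u_2)$ exists for almost all $u_2\in(0,\infty)$, and then $0\ge\dot\Gamma_2(u_1,u_2)\ge-u_2^{-2}$; and the mapping $u_1\mapsto\dot\Gamma_2(u_1,u_2)$ is defined and nondecreasing almost everywhere.
   Context: A bivariate Pareto–Lévy copula (for Lévy processes with positive jumps) is a function $\Gamma:[0,\infty]^2\setminus\{(0,0)\}\to[0,\infty)$ which (a) is grounded: $\Gamma(u,\infty)=\Gamma(\infty,u)=0$ for all $u\in(0,\infty]$; (b) has Pareto margins: $\Gamma(u,0)=\Gamma(0,u)=1/u$ for all $u\in(0,\infty]$; (c) is 2-increasing: $\Gamma(x_1,x_2)-\Gamma(x_1,y_2)-\Gamma(y_1,x_2)+\Gamma(y_1,y_2)\ge0$ for all $x_1\le y_1$, $x_2\le y_2$ (for which all terms are defined). Conventions: $1/\infty=0$, $1/0=\infty$, $\infty\cdot0=0$ in products with indicators, and $|\infty-\infty|=0$ in (i). $\dot\Gamma_i$ denotes the partial derivative of $\Gamma$ with respect to its $i$-th argument; "almost all" and "almost everywhere" refer to Lebesgue measure. *)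

theory Defs
  imports "HOL-Analysis.Analysis"
begin

text \<open>
  The interval \<open>[0,\<infinity>]\<close> is the type \<^typ>\<open>ennreal\<close>, whose division satisfies \<open>1/0 = \<infinity>\<close>,
  \<open>1/\<infinity> = 0\<close> and \<open>\<infinity> * 0 = 0\<close>. A function on \<open>[0,\<infinity>]\<^sup>2 \<setminus> {(0,0)}\<close> is a total function of which only
  the values on \<open>pl_dom\<close> matter; no condition is ever imposed on its value at \<open>(0,0)\<close>.
\<close>

definition pl_dom :: "(ennreal \<times> ennreal) set" where
  "pl_dom = UNIV - {(0, 0)}"

definition two_increasing :: "(ennreal \<times> ennreal \<Rightarrow> real) \<Rightarrow> bool" where
  "two_increasing G \<longleftrightarrow>
    (\<forall>x1 y1 x2 y2. x1 \<le> y1 \<longrightarrow> x2 \<le> y2 \<longrightarrow> {(x1, x2), (x1, y2), (y1, x2), (y1, y2)} \<subseteq> pl_dom \<longrightarrow>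
      G (x1, x2) - G (x1, y2) - G (y1, x2) + G (y1, y2) \<ge> 0)"

definition pareto_levy_copula :: "(ennreal \<times> ennreal \<Rightarrow> real) \<Rightarrow> bool" where
  "pareto_levy_copula G \<longleftrightarrow>
    (\<forall>u\<in>pl_dom. G u \<ge> 0) \<and>
    (\<forall>u>0. G (u, \<infinity>) = 0 \<and> G (\<infinity>, u) = 0) \<and>
    (\<forall>u>0. G (u, 0) = enn2real (1 / u) \<and> G (0, u) = enn2real (1 / u)) \<and>
    two_increasing G"

text \<open>The distance \<open>\<bar>a - b\<bar>\<close> in \<open>[0,\<infinity>]\<close>, with \<open>\<bar>\<infinity> - \<infinity>\<bar> = 0\<close>. The case \<open>a = b\<close> is separate because
  subtraction on \<^typ>\<open>ennreal\<close> has \<open>\<infinity> - \<infinity> = \<infinity>\<close>.\<close>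

definition ennreal_dist :: "ennreal \<Rightarrow> ennreal \<Rightarrow> ennreal" where
  "ennreal_dist a b = (if a = b then 0 else max a b - min a b)"

text \<open>On \<open>pl_dom\<close> the arguments of \<^const>\<open>enn2real\<close> in the next two definitions are finite.\<close>

definition pl_copula_dep :: "ennreal \<times> ennreal \<Rightarrow> real" where
  "pl_copula_dep u = enn2real (1 / max (fst u) (snd u))"

definition pl_copula_indep :: "ennreal \<times> ennreal \<Rightarrow> real" where
  "pl_copula_indep u =
    enn2real (1 / fst u * indicator {0} (snd u) + 1 / snd u * indicator {0} (fst u))"

text \<open>Partial derivatives, used only where the variable of differentiation is positive and finite,
  so that \<^const>\<open>ennreal\<close> is the inclusion near that point. The argument held fixed
  may be any element of \<open>[0,\<infinity>]\<close>.\<close>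

definition has_partial1 :: "(ennreal \<times> ennreal \<Rightarrow> real) \<Rightarrow> real \<Rightarrow> real \<Rightarrow> ennreal \<Rightarrow> bool" where
  "has_partial1 G D u1 u2 \<longleftrightarrow> ((\<lambda>t. G (ennreal t, u2)) has_real_derivative D) (at u1)"

definition has_partial2 :: "(ennreal \<times> ennreal \<Rightarrow> real) \<Rightarrow> real \<Rightarrow> ennreal \<Rightarrow> real \<Rightarrow> bool" where
  "has_partial2 G D u1 u2 \<longleftrightarrow> ((\<lambda>t. G (u1, ennreal t)) has_real_derivative D) (at u2)"

definition partial1_exists :: "(ennreal \<times> ennreal \<Rightarrow> real) \<Rightarrow> real \<Rightarrow> ennreal \<Rightarrow> bool" where
  "partial1_exists G u1 u2 \<longleftrightarrow> (\<exists>D. has_partial1 G D u1 u2)"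

definition partial2_exists :: "(ennreal \<times> ennreal \<Rightarrow> real) \<Rightarrow> ennreal \<Rightarrow> real \<Rightarrow> bool" where
  "partial2_exists G u1 u2 \<longleftrightarrow> (\<exists>D. has_partial2 G D u1 u2)"

definition partial1 :: "(ennreal \<times> ennreal \<Rightarrow> real) \<Rightarrow> real \<Rightarrow> ennreal \<Rightarrow> real" where
  "partial1 G u1 u2 = deriv (\<lambda>t. G (ennreal t, u2)) u1"

definition partial2 :: "(ennreal \<times> ennreal \<Rightarrow> real) \<Rightarrow> ennreal \<Rightarrow> real \<Rightarrow> real" where
  "partial2 G u1 u2 = deriv (\<lambda>t. G (u1, ennreal t)) u2"

lemma has_partial1_partial1:
  "has_partial1 G D u1 u2 \<Longrightarrow> partial1 G u1 u2 = D"
  unfolding has_partial1_def partial1_def by (rule DERIV_imp_deriv)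

lemma has_partial2_partial2:
  "has_partial2 G D u1 u2 \<Longrightarrow> partial2 G u1 u2 = D"
  unfolding has_partial2_def partial2_def by (rule DERIV_imp_deriv)

lemma enn2real_inverse_antimono:
  assumes "(0::ennreal) < x" "x \<le> y"
  shows "enn2real (1 / y) \<le> enn2real (1 / x)"
proof (rule enn2real_mono)
  show "1 / y \<le> 1 / x"
    using assms(2) ereal_inverse_antimono[of "enn2ereal x" "enn2ereal y"]
    by (simp add: divide_ennreal_def less_eq_ennreal.rep_eq inverse_ennreal.rep_eq)
  show "1 / x < top"
    using assms(1) by (simp add: divide_ennreal_def ennreal_inverse_eq_top_iff less_top[symmetric])
qed

lemma pareto_levy_copula_dep: "pareto_levy_copula pl_copula_dep"
proof -
  have *: "pl_copula_dep (x1, x2) - pl_copula_dep (x1, y2) - pl_copula_dep (y1, x2)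
          + pl_copula_dep (y1, y2) \<ge> 0"
    if le: "x1 \<le> y1" "x2 \<le> y2" and dom: "(x1, x2) \<in> pl_dom" for x1 y1 x2 y2
  proof -
    have pos: "0 < max x1 x2"
      using dom by (auto simp: pl_dom_def max_def zero_less_iff_neq_zero)
    define f where "f z = enn2real (1 / z)" for z :: ennreal
    have anti: "f b \<le> f a" if "max x1 x2 \<le> a" "a \<le> b" for a b
      unfolding f_def using pos that by (intro enn2real_inverse_antimono) (auto elim: less_le_trans)
    have "f (max x1 x2) - f (max x1 y2) - f (max y1 x2) + f (max y1 y2) \<ge> 0"
    proof (cases "y1 \<le> y2")
      case True
      then have "max x1 y2 = y2" "max y1 y2 = y2"
        using le by (auto simp: max_absorb2)
      moreover have "f (max y1 x2) \<le> f (max x1 x2)"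
        using le by (intro anti) (auto simp: le_max_iff_disj)
      ultimately show ?thesis by simp
    next
      case False
      then have "max y1 x2 = y1" "max y1 y2 = y1"
        using le by (auto simp: max_absorb1)
      moreover have "f (max x1 y2) \<le> f (max x1 x2)"
        using le by (intro anti) (auto simp: le_max_iff_disj)
      ultimately show ?thesis by simp
    qed
    then show ?thesis by (simp add: pl_copula_dep_def f_def)
  qed
  show ?thesis
    unfolding pareto_levy_copula_def two_increasing_def
    using * by (auto simp: pl_copula_dep_def max_def top_unique)
qed

lemma pareto_levy_copula_indep: "pareto_levy_copula pl_copula_indep"
proof -
  have *: "pl_copula_indep (x1, x2) - pl_copula_indep (x1, y2) - pl_copula_indep (y1, x2)
          + pl_copula_indep (y1, y2) \<ge> 0"
    if "x1 \<le> y1" "x2 \<le> y2" "(x1, x2) \<in> pl_dom" for x1 y1 x2 y2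
    using that enn2real_inverse_antimono[of x1 y1] enn2real_inverse_antimono[of x2 y2]
    by (auto simp: pl_copula_indep_def pl_dom_def indicator_def zero_less_iff_neq_zero)
  show ?thesis
    unfolding pareto_levy_copula_def two_increasing_def
    using * by (auto simp: pl_copula_indep_def indicator_def)
qed

end

theory Submission
  imports Defs
begin

text \<open>
  The 2-increasing property, applied to rectangles with one side on the boundary, carries everything.
  A rectangle reaching \<open>\<infinity>\<close>, where a copula vanishes, shows that \<open>G\<close> is antitone in each argument
  (\<open>pl_copula_antimono\<close>); a rectangle starting at \<open>0\<close>, where the margin is \<open>1/u\<close>, shows that
  \<open>G(u, v) - 1/u\<close> is monotone in \<open>u\<close> (\<open>pl_copula_decrement_le\<close>). Together they give the
  Lipschitz estimate, the Frechet-Hoeffding bounds and, by differentiation, the bounds on the partial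
  derivatives.

  In the variable \<open>s = 1/u\<close> the two facts say that \<open>s \<mapsto> G(1/s, v)\<close> is monotone and that \<open>s\<close> minus it
  is monotone as well. Such a function \<open>f\<close> is differentiable almost everywhere
  (\<open>nonexpansive_mono_differentiable_ae\<close>). Indeed, the Stieltjes measures of \<open>f\<close> and of
  \<open>x \<mapsto> x - f x\<close> add up to Lebesgue measure. At points where the difference quotients of \<open>f\<close>
  accumulate both below \<open>p\<close> and above \<open>q\<close>, with \<open>p < q\<close>, Vitali's covering theorem bounds the
  first measure by \<open>p\<close> and the second by \<open>1 - q\<close> times the measure of any open set around these
  points; so their outer measure is at most \<open>1 - (q - p)\<close> times itself, hence zero.

  Now let the other argument vary. For almost every \<open>u\<^sub>1\<close> the partial derivative
  exists at all rational \<open>u\<^sub>2\<close>. The 2-increasing property makes increments of \<open>G\<close> in \<open>u\<^sub>1\<close> monotone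
  in \<open>u\<^sub>2\<close>, so the derivatives at rational points form a monotone function, and at any other \<open>u\<^sub>2\<close> the
  difference quotients are squeezed between those at neighbouring rationals. The derivative
  therefore exists except at the countably many jumps of a monotone function
  (\<open>countable_not_differentiable_monotone_family\<close>).

  The statements about the second argument follow from those about the first, since exchanging the
  arguments of a Pareto-Levy copula gives a Pareto-Levy copula.
\<close>

section \<open>Consequences of the 2-increasing property\<close>

lemma pl_copula_two_increasing:
  assumes "pareto_levy_copula G" "x1 \<le> y1" "x2 \<le> y2" "(x1, x2) \<in> pl_dom"
  shows "G (x1, y2) + G (y1, x2) \<le> G (x1, x2) + G (y1, y2)"
proof -
  have "{(x1, x2), (x1, y2), (y1, x2), (y1, y2)} \<subseteq> pl_dom"
    using assms(2-4) by (auto simp: pl_dom_def)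
  then have "0 \<le> G (x1, x2) - G (x1, y2) - G (y1, x2) + G (y1, y2)"
    using assms(1-3) unfolding pareto_levy_copula_def two_increasing_def by blast
  then show ?thesis by simp
qed

text \<open>
  At \<open>u = 0\<close> the value comes from the margin, \<open>1/\<infinity> = 0\<close>.
\<close>

lemma pl_copula_grounded:
  assumes "pareto_levy_copula G"
  shows "G (u, \<infinity>) = 0" "G (\<infinity>, u) = 0"
  using assms by (cases "u = 0"; auto simp: pareto_levy_copula_def zero_less_iff_neq_zero)+

lemma pl_copula_margin:
  assumes "pareto_levy_copula G" "0 < u"
  shows "G (u, 0) = enn2real (1 / u)" "G (0, u) = enn2real (1 / u)"
  using assms by (auto simp: pareto_levy_copula_def)

lemma pl_copula_swap:
  assumes "pareto_levy_copula G"
  shows "pareto_levy_copula (G \<circ> prod.swap)"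
  unfolding pareto_levy_copula_def two_increasing_def
proof (intro conjI allI impI ballI)
  fix x1 y1 x2 y2
  assume "x1 \<le> y1" "x2 \<le> y2" "{(x1, x2), (x1, y2), (y1, x2), (y1, y2)} \<subseteq> pl_dom"
  then show "0 \<le> (G \<circ> prod.swap) (x1, x2) - (G \<circ> prod.swap) (x1, y2)
      - (G \<circ> prod.swap) (y1, x2) + (G \<circ> prod.swap) (y1, y2)"
    using pl_copula_two_increasing[OF assms, of x2 y2 x1 y1] by (auto simp: pl_dom_def)
qed (use assms in \<open>auto simp: pareto_levy_copula_def pl_dom_def\<close>)

text \<open>
  On the rectangle \<open>[u, u'] \<times> [v, \<infinity>]\<close> the upper corners contribute nothing.
\<close>

lemma pl_copula_antimono:
  assumes G: "pareto_levy_copula G" and "(u, v) \<in> pl_dom" "u \<le> u'"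
  shows "G (u', v) \<le> G (u, v)"
  using pl_copula_two_increasing[OF G assms(3) _ assms(2), of \<infinity>] pl_copula_grounded[OF G]
  by simp

text \<open>
  On the rectangle \<open>[u, u'] \<times> [0, v]\<close> the lower corners contribute the margins \<open>1/u\<close> and \<open>1/u'\<close>.
\<close>

lemma pl_copula_decrement_le:
  assumes G: "pareto_levy_copula G" and "0 < u" "u \<le> u'"
  shows "G (u, v) - G (u', v) \<le> enn2real (1 / u) - enn2real (1 / u')"
  using pl_copula_two_increasing[OF G assms(3), of 0 v] pl_copula_margin(1)[OF G, of u]
    pl_copula_margin(1)[OF G, of u'] assms less_le_trans[OF assms(2,3)]
  by (simp add: pl_dom_def zero_less_iff_neq_zero)

lemma ennreal_dist_commute: "ennreal_dist a b = ennreal_dist b a"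
  by (auto simp: ennreal_dist_def max.commute min.commute)

lemma ennreal_dist_reciprocal_zero:
  assumes "u \<noteq> 0"
  shows "ennreal_dist (1 / 0) (1 / u) = \<infinity>"
proof -
  have "1 / u \<noteq> \<infinity>"
    using assms by (simp add: divide_ennreal_def ennreal_inverse_eq_top_iff)
  then show ?thesis
    by (simp add: ennreal_dist_def max_def min_def top_unique)
qed

lemma ennreal_dist_ennreal:
  assumes "0 \<le> b" "b \<le> a"
  shows "ennreal_dist (ennreal a) (ennreal b) = ennreal (a - b)"
  using assms by (auto simp: ennreal_dist_def max_def min_def ennreal_minus)

lemma one_divide_ennreal_finite:
  assumes "0 < (u::ennreal)"
  shows "1 / u = ennreal (enn2real (1 / u))"
  using assms by (simp add: divide_ennreal_def ennreal_inverse_eq_top_iff less_top[symmetric])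

lemma pl_copula_lipschitz_fst:
  assumes G: "pareto_levy_copula G" and dom: "(u, v) \<in> pl_dom" "(u', v) \<in> pl_dom"
  shows "ennreal \<bar>G (u, v) - G (u', v)\<bar> \<le> ennreal_dist (1 / u) (1 / u')"
  using dom
proof (induction u u' rule: linorder_wlog)
  case (le u u')
  consider "u = u'" | "u = 0" "u' \<noteq> 0" | "0 < u"
    by (metis zero_less_iff_neq_zero)
  then show ?case
  proof cases
    case 2
    then show ?thesis
      using ennreal_dist_reciprocal_zero[of u'] by simp
  next
    case 3
    have anti: "enn2real (1 / u') \<le> enn2real (1 / u)"
      using 3 le(1) by (rule enn2real_inverse_antimono)
    have "ennreal \<bar>G (u, v) - G (u', v)\<bar> \<le> ennreal (enn2real (1 / u) - enn2real (1 / u'))"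
      using pl_copula_antimono[OF G le(2,1)] pl_copula_decrement_le[OF G 3 le(1), of v]
      by (intro ennreal_leI) simp
    also have "\<dots> = ennreal_dist (1 / u) (1 / u')"
      using anti 3 le(1) one_divide_ennreal_finite[of u] one_divide_ennreal_finite[of u']
        ennreal_dist_ennreal[of "enn2real (1 / u')" "enn2real (1 / u)"] by simp
    finally show ?thesis .
  qed simp
next
  case (sym u u')
  then show ?case
    by (simp add: ennreal_dist_commute abs_minus_commute)
qed

text \<open>
  The two points are joined by changing one coordinate at a time, through \<open>(v\<^sub>1, u\<^sub>2)\<close>. If that is the
  excluded origin, then \<open>v\<^sub>1 = 0 \<noteq> u\<^sub>1\<close> and the right-hand side is infinite.
\<close>

lemma pl_copula_lipschitz:
  assumes G: "pareto_levy_copula G" and dom: "u \<in> pl_dom" "v \<in> pl_dom"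
  shows "ennreal \<bar>G u - G v\<bar> \<le>
    ennreal_dist (1 / fst u) (1 / fst v) + ennreal_dist (1 / snd u) (1 / snd v)"
proof -
  obtain u1 u2 v1 v2 where uv: "u = (u1, u2)" "v = (v1, v2)"
    by (metis prod.exhaust)
  let ?d1 = "ennreal_dist (1 / u1) (1 / v1)" and ?d2 = "ennreal_dist (1 / u2) (1 / v2)"
  show ?thesis
  proof (cases "(v1, u2) \<in> pl_dom")
    case True
    have "ennreal \<bar>G u - G v\<bar> \<le> ennreal (\<bar>G (u1, u2) - G (v1, u2)\<bar> + \<bar>G (v1, u2) - G (v1, v2)\<bar>)"
      unfolding uv by (intro ennreal_leI) simp
    also have "\<dots> = ennreal \<bar>G (u1, u2) - G (v1, u2)\<bar> + ennreal \<bar>G (v1, u2) - G (v1, v2)\<bar>"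
      by (intro ennreal_plus) auto
    also have "\<dots> \<le> ?d1 + ?d2"
      using pl_copula_lipschitz_fst[OF G, of u1 u2 v1]
        pl_copula_lipschitz_fst[OF pl_copula_swap[OF G], of u2 v1 v2] True dom uv
      by (intro add_mono) (auto simp: pl_dom_def)
    finally show ?thesis by (simp add: uv)
  next
    case False
    then have "v1 = 0" "u1 \<noteq> 0"
      using dom uv by (auto simp: pl_dom_def)
    then have "?d1 = \<infinity>"
      using ennreal_dist_reciprocal_zero[of u1] ennreal_dist_commute[of "1 / u1"] by simp
    then show ?thesis by (simp add: uv)
  qed
qed

text \<open>
  The decrement from \<open>u\<close> to \<open>\<infinity>\<close> in the larger coordinate \<open>u\<close> is at most \<open>1/u\<close>.
\<close>

lemma pl_copula_le_dep:
  assumes G: "pareto_levy_copula G" and "u \<in> pl_dom"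
  shows "G u \<le> pl_copula_dep u"
proof -
  obtain u1 u2 where u: "u = (u1, u2)" by (cases u)
  have *: "H (a, b) \<le> enn2real (1 / a)" if "pareto_levy_copula H" "0 < a" for H a b
    using pl_copula_decrement_le[OF that, of \<infinity> b] pl_copula_grounded[OF that(1)] by simp
  show ?thesis
  proof (cases "u2 \<le> u1")
    case True
    then have "0 < u1"
      using assms(2) by (auto simp: u pl_dom_def zero_less_iff_neq_zero)
    then show ?thesis
      using *[OF G, of u1 u2] True by (simp add: u pl_copula_dep_def max_absorb1)
  next
    case False
    then have "0 < u2"
      by (auto simp: zero_less_iff_neq_zero)
    then show ?thesis
      using *[OF pl_copula_swap[OF G], of u2 u1] False
      by (simp add: u pl_copula_dep_def max_absorb2)
  qed
qed

text \<open>
  The independence copula vanishes off the axes and has the prescribed margins on them.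
\<close>

lemma pl_copula_indep_le:
  assumes G: "pareto_levy_copula G" and "u \<in> pl_dom"
  shows "pl_copula_indep u \<le> G u"
proof -
  obtain u1 u2 where u: "u = (u1, u2)" by (cases u)
  have "0 \<le> G u"
    using assms by (simp add: pareto_levy_copula_def)
  then show ?thesis
    using pl_copula_margin[OF G, of u1] pl_copula_margin[OF G, of u2] assms(2)
    by (auto simp: u pl_copula_indep_def pl_dom_def indicator_def zero_less_iff_neq_zero)
qed

section \<open>Differentiability of monotone nonexpansive functions\<close>

lemma nonexpansive_imp_continuous:
  fixes f :: "real \<Rightarrow> real"
  assumes "mono f" "mono (\<lambda>x. x - f x)"
  shows "continuous_on UNIV f"
proof (rule lipschitz_on_continuous_on)
  have "\<bar>f x - f y\<bar> \<le> \<bar>x - y\<bar>" for x y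
    using monoD[OF assms(1), of x y] monoD[OF assms(1), of y x]
      monoD[OF assms(2), of x y] monoD[OF assms(2), of y x] by (cases "x \<le> y") auto
  then show "1-lipschitz_on UNIV f"
    by (auto intro!: lipschitz_onI simp: dist_real_def)
qed

text \<open>
  Continuity removes the atoms, so the open interval has the measure of the closed one.
\<close>

lemma emeasure_interval_measure_Ioo:
  fixes f :: "real \<Rightarrow> real"
  assumes f: "mono f" "continuous_on UNIV f" and "a \<le> b"
  shows "emeasure (interval_measure f) {a<..<b} = f b - f a"
proof (cases "a = b")
  case False
  let ?M = "interval_measure f"
  have Icc: "emeasure ?M {x..y} = f y - f x" if "x \<le> y" for x y
    using that f by (intro emeasure_interval_measure_Icc) (auto simp: mono_def)
  have "{a} \<in> null_sets ?M" "{b} \<in> null_sets ?M"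
    using Icc[of a a] Icc[of b b] by (auto simp: null_sets_def)
  then have "{a} \<union> {b} \<in> null_sets ?M"
    by (rule null_sets.Un)
  moreover have "{a<..<b} = {a..b} - ({a} \<union> {b})" by auto
  ultimately show ?thesis
    using Icc[OF \<open>a \<le> b\<close>] by (simp add: emeasure_Diff_null_set)
qed simp

text \<open>
  Lebesgue measure is determined by the lengths of intervals, and the increments of \<open>f\<close> and of
  \<open>x \<mapsto> x - f x\<close> over an interval add up to its length. In particular both Stieltjes measures are
  absolutely continuous.
\<close>

lemma lborel_split:
  fixes f :: "real \<Rightarrow> real"
  assumes f: "mono f" and g: "mono (\<lambda>x. x - f x)" and A: "A \<in> sets borel"
  shows "emeasure lborel A =
    emeasure (interval_measure f) A + emeasure (interval_measure (\<lambda>x. x - f x)) A"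
proof -
  let ?g = "\<lambda>x. x - f x"
  let ?m = "\<lambda>A. emeasure (interval_measure f) A + emeasure (interval_measure ?g) A"
  let ?M = "measure_of UNIV (sets borel) ?m"
  have cf: "continuous_on UNIV f"
    using f g by (rule nonexpansive_imp_continuous)
  then have cg: "continuous_on UNIV ?g"
    by (intro continuous_intros)
  have add: "countably_additive (sets borel) ?m"
    by (intro countably_additiveI)
       (simp add: suminf_add[symmetric] suminf_emeasure[symmetric])
  have em: "emeasure ?M B = ?m B" if "B \<in> sets borel" for B
    by (rule emeasure_measure_of_sigma[OF _ _ add that])
       (use sets.sigma_algebra_axioms[of "borel :: real measure"] in \<open>auto simp: positive_def\<close>)
  have "lborel = ?M"
  proof (rule lborel_eqI)
    fix l u :: real
    assume le: "\<And>b. b \<in> Basis \<Longrightarrow> l \<bullet> b \<le> u \<bullet> b"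
    then have "l \<le> u" by simp
    then have "?m {l<..<u} = ennreal (f u - f l) + ennreal (?g u - ?g l)"
      by (simp only: emeasure_interval_measure_Ioo[OF f cf] emeasure_interval_measure_Ioo[OF g cg])
    also have "\<dots> = ennreal (u - l)"
      using monoD[OF f \<open>l \<le> u\<close>] monoD[OF g \<open>l \<le> u\<close>]
      by (subst ennreal_plus[symmetric]) auto
    finally show "emeasure ?M (box l u) = (\<Prod>b\<in>Basis. (u - l) \<bullet> b)"
      using em[of "{l<..<u}"] by (simp add: box_real)
  qed (use sets.sigma_sets_eq[of "borel :: real measure"] in simp)
  then show ?thesis
    by (rule ssubst) (rule em[OF A])
qed

text \<open>
  The intervals on which the mean slope of \<open>f\<close> is at most \<open>p\<close> form a Vitali cover of \<open>S\<close>. A disjoint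
  subfamily inside \<open>U\<close> covers \<open>S\<close> up to a null set, which the Stieltjes measure of \<open>f\<close> does not
  charge either, and on each of its members that measure is at most \<open>p\<close> times the length.
  The set \<open>S\<close> is arbitrary, hence the conclusion about a Borel superset \<open>T\<close>.
\<close>

lemma Vitali_slope_bound:
  fixes f :: "real \<Rightarrow> real"
  assumes f: "mono f" and g: "mono (\<lambda>x. x - f x)"
    and U: "open U" "S \<subseteq> U" and p: "0 \<le> p"
    and slope: "\<And>x. x \<in> S \<Longrightarrow> frequently (\<lambda>y. (f y - f x) / (y - x) \<le> p) (at x)"
  obtains T where "T \<in> sets borel" "S \<subseteq> T"
    "emeasure (interval_measure f) T \<le> ennreal p * emeasure lborel U"
proof -
  let ?M = "interval_measure f"
  \<comment> \<open>an interval is encoded by its endpoints; \<open>a\<close> and \<open>r\<close> are its centre and radius\<close>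
  define a r where "a = (\<lambda>i::real\<times>real. (fst i + snd i) / 2)"
    and "r = (\<lambda>i::real\<times>real. (snd i - fst i) / 2)"
  define K where "K = {(c, d). c < d \<and> {c..d} \<subseteq> U \<and> f d - f c \<le> p * (d - c)}"
  have cb: "cball (a i) (r i) = {fst i..snd i}" for i
  proof -
    have "a i - r i = fst i" "a i + r i = snd i"
      by (simp_all add: a_def r_def field_simps)
    then show ?thesis
      by (simp add: cball_eq_atLeastAtMost)
  qed
  have cf: "continuous_on UNIV f"
    using f g by (rule nonexpansive_imp_continuous)
  obtain C where C: "countable C" "C \<subseteq> K"
    and disj: "pairwise (\<lambda>i j. disjnt (cball (a i) (r i)) (cball (a j) (r j))) C"
    and neg: "negligible (S - (\<Union>i\<in>C. cball (a i) (r i)))"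
  proof (rule Vitali_covering_theorem_cballs[of K r S a])
    show "0 < r i" if "i \<in> K" for i
      using that by (auto simp: K_def r_def)
    fix x \<delta> :: real
    assume x: "x \<in> S" "0 < \<delta>"
    obtain e where e: "e > 0" "cball x e \<subseteq> U"
      using U x by (meson open_contains_cball subsetD)
    have "eventually (\<lambda>y. y \<noteq> x \<and> dist y x < min e \<delta>) (at x)"
      using e x by (auto simp: eventually_at intro!: exI[of _ "min e \<delta>"])
    then obtain y where y: "(f y - f x) / (y - x) \<le> p" "y \<noteq> x" "dist y x < min e \<delta>"
      using frequently_eventually_frequently[OF slope[OF x(1)]] frequently_ex by (smt (verit, best))
    let ?i = "(min x y, max x y)"
    have "{min x y..max x y} \<subseteq> U"
      using y(3) by (intro order.trans[OF _ e(2)]) (auto simp: dist_real_def)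
    moreover have "f (max x y) - f (min x y) \<le> p * (max x y - min x y)"
      using y(1,2) by (auto simp: max_def min_def field_simps split: if_splits)
    ultimately have "?i \<in> K"
      using y(2) by (auto simp: K_def)
    moreover have "x \<in> cball (a ?i) (r ?i)" "r ?i < \<delta>"
      using y(3) unfolding cb by (auto simp: r_def dist_real_def)
    ultimately show "\<exists>i. i \<in> K \<and> x \<in> cball (a i) (r i) \<and> r i < \<delta>"
      by blast
  qed
  let ?I = "\<lambda>i. {fst i..snd i::real}"
  have dj: "disjoint_family_on ?I C"
    using disj unfolding cb by (auto simp: disjoint_family_on_def pairwise_def disjnt_def)
  obtain N where N: "N \<in> null_sets lborel" "S - (\<Union>i\<in>C. ?I i) \<subseteq> N"
    using neg unfolding cb negligible_iff_null_sets null_sets_completion_iff2 by auto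
  let ?T = "(\<Union>i\<in>C. ?I i) \<union> N"
  have UN: "(\<Union>i\<in>C. ?I i) \<in> sets borel"
    using C(1) by (intro sets.countable_UN') auto
  have Nb: "N \<in> sets borel"
    using N(1) by auto
  have N0: "emeasure ?M N = 0"
    using lborel_split[OF f g Nb] N(1) by (simp add: null_sets_def)
  have "emeasure ?M ?T \<le> emeasure ?M (\<Union>i\<in>C. ?I i) + emeasure ?M N"
    by (rule emeasure_subadditive) (use UN Nb in auto)
  also have "\<dots> = (\<integral>\<^sup>+i. emeasure ?M (?I i) \<partial>count_space C)"
    using C(1) dj by (simp add: N0 emeasure_UN_countable)
  also have "\<dots> \<le> (\<integral>\<^sup>+i. ennreal p * emeasure lborel (?I i) \<partial>count_space C)"
  proof (rule nn_integral_mono)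
    fix i assume "i \<in> space (count_space C)"
    then have i: "fst i < snd i" "f (snd i) - f (fst i) \<le> p * (snd i - fst i)"
      using C(2) by (auto simp: K_def)
    have "emeasure ?M (?I i) = f (snd i) - f (fst i)"
      using i f cf by (intro emeasure_interval_measure_Icc) (auto simp: mono_def)
    then show "emeasure ?M (?I i) \<le> ennreal p * emeasure lborel (?I i)"
      using i p by (simp add: ennreal_mult[symmetric])
  qed
  also have "\<dots> = ennreal p * (\<integral>\<^sup>+i. emeasure lborel (?I i) \<partial>count_space C)"
    by (rule nn_integral_cmult) auto
  also have "(\<integral>\<^sup>+i. emeasure lborel (?I i) \<partial>count_space C) = emeasure lborel (\<Union>i\<in>C. ?I i)"
    using C(1) dj by (subst emeasure_UN_countable) auto
  also have "ennreal p * \<dots> \<le> ennreal p * emeasure lborel U"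
  proof (intro mult_left_mono emeasure_mono)
    show "(\<Union>i\<in>C. ?I i) \<subseteq> U"
      using C(2) unfolding K_def by fastforce
  qed (use U(1) in auto)
  finally show thesis
    using N(2) UN Nb by (intro that[of ?T]) auto
qed

text \<open>
  Applied to open sets whose measure tends to the outer measure \<open>m\<close> of \<open>S\<close>, the assumption gives
  \<open>m \<le> c * m\<close>; boundedness of \<open>S\<close> makes \<open>m\<close> finite, so \<open>m = 0\<close>.
\<close>

lemma negligible_if_covers_shrink:
  fixes S :: "'a::euclidean_space set"
  assumes "bounded S" and c: "0 \<le> c" "c < 1"
    and shrink: "\<And>U. open U \<Longrightarrow> S \<subseteq> U \<Longrightarrow>
      \<exists>T\<in>sets borel. S \<subseteq> T \<and> emeasure lborel T \<le> ennreal c * emeasure lborel U"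
  shows "negligible S"
proof -
  have "S \<subseteq> space lborel" by simp
  from outer_measure_of_attain[OF this]
  obtain E where E: "E \<in> sets borel" "S \<subseteq> E" "outer_measure_of lborel S = emeasure lborel E"
    unfolding sets_lborel by blast
  obtain B where "\<And>x. x \<in> S \<Longrightarrow> norm x \<le> B"
    using \<open>bounded S\<close> by (auto simp: bounded_iff)
  then have B: "S \<subseteq> cball 0 B" by auto
  have "emeasure lborel E \<le> emeasure lborel (cball (0::'a) B)"
    unfolding E(3)[symmetric] using outer_measure_of_mono[OF B, of lborel] by simp
  also have "\<dots> < \<infinity>"
    by (rule emeasure_lborel_cball_finite)
  finally have "\<exists>m\<ge>0. emeasure lborel E = ennreal m"
    by (simp only: infinity_ennreal_def less_top_ennreal)
  then obtain m where m: "emeasure lborel E = ennreal m" "0 \<le> m"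
    by blast
  have le: "m \<le> c * (m + e)" if "e > 0" for e
  proof -
    have "E \<in> sets lebesgue" using E(1) by simp
    from sets_lebesgue_outer_open[OF this \<open>e > 0\<close>]
    obtain U where U: "open U" "E \<subseteq> U" "emeasure lebesgue (U - E) < ennreal e"
      by metis
    have Ub: "U - E \<in> sets borel" using U(1) E(1) by auto
    have "emeasure lborel U \<le> emeasure lborel E + emeasure lborel (U - E)"
      using E(1) U(2) Ub by (subst plus_emeasure) (auto simp: Un_absorb1)
    also have "\<dots> \<le> ennreal m + ennreal e"
      using U(3) Ub m by (intro add_mono) auto
    finally have "emeasure lborel U \<le> ennreal (m + e)"
      using m \<open>e > 0\<close> by simp
    moreover obtain T where T: "T \<in> sets borel" "S \<subseteq> T"
      "emeasure lborel T \<le> ennreal c * emeasure lborel U"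
      using shrink[of U] U E(2) by blast
    moreover have "emeasure lborel E \<le> emeasure lborel T"
      unfolding E(3)[symmetric] using outer_measure_of_mono[OF T(2), of lborel] T(1) by simp
    ultimately have "ennreal m \<le> ennreal c * ennreal (m + e)"
      using m by (metis mult_left_mono order.trans zero_le)
    then show ?thesis
      using c m \<open>e > 0\<close> by (simp add: ennreal_mult[symmetric] del: ennreal_plus)
  qed
  have "m \<le> c * m"
  proof (rule field_le_epsilon)
    fix e :: real assume "e > 0"
    then have "m \<le> c * m + c * e"
      using le[of e] by (simp add: algebra_simps)
    also have "c * e \<le> e"
      using c \<open>e > 0\<close> by (simp add: mult_left_le_one_le)
    finally show "m \<le> c * m + e" by simp
  qed
  moreover have "c * m < m" if "0 < m"
    using that c by simp
  ultimately have "m = 0"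
    using m(2) by (cases "0 < m") auto
  then have "E \<in> null_sets lborel"
    using E(1) m by (simp add: null_sets_def)
  then show ?thesis
    using E(2) unfolding negligible_iff_null_sets null_sets_completion_iff2 by blast
qed

text \<open>
  Without a limit, the lower and upper limits differ, and rationals fit between them. Rational
  levels keep the number of exceptional sets countable later on.
\<close>

lemma slope_limit_or_oscillation:
  fixes Q :: "'a \<Rightarrow> real"
  assumes F: "F \<noteq> bot" and Q: "\<And>y. 0 \<le> Q y" "\<And>y. Q y \<le> 1"
    and not_conv: "\<not> (\<exists>D. (Q \<longlongrightarrow> D) F)"
  obtains p q :: rat where "of_rat p < (of_rat q :: real)"
    "frequently (\<lambda>y. Q y \<le> of_rat p) F" "frequently (\<lambda>y. Q y \<ge> of_rat q) F"
proof -
  let ?l = "Liminf F (\<lambda>y. ereal (Q y))" and ?L = "Limsup F (\<lambda>y. ereal (Q y))"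
  have "?l \<le> ?L" by (rule Liminf_le_Limsup[OF F])
  have bd: "0 \<le> ?l" "?L \<le> 1"
    using Q by (auto intro!: Liminf_bounded Limsup_bounded)
  have "?l \<noteq> ?L"
  proof
    assume eq: "?l = ?L"
    with bd have "0 \<le> ?L" "?L \<le> 1" by auto
    then have "\<bar>?L\<bar> \<noteq> \<infinity>" by auto
    then obtain D where "?L = ereal D" by auto
    then have "((\<lambda>y. ereal (Q y)) \<longlongrightarrow> ereal D) F"
      using eq F by (subst tendsto_iff_Liminf_eq_Limsup) auto
    then show False
      using not_conv by auto
  qed
  with \<open>?l \<le> ?L\<close> have "?l < ?L" by simp
  then obtain b where b: "?l < ereal b" "ereal b < ?L"
    using ereal_dense2 by blast
  then obtain a where a: "?l < ereal a" "ereal a < ereal b"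
    using ereal_dense2 by blast
  obtain p where p: "a < of_rat p" "of_rat p < b"
    using a(2) of_rat_dense[of a b] by auto
  obtain c where c: "ereal b < ereal c" "ereal c < ?L"
    using b ereal_dense2 by blast
  obtain q where q: "b < of_rat q" "of_rat q < c"
    using c(1) of_rat_dense[of b c] by auto
  show thesis
  proof
    show "(of_rat p :: real) < of_rat q" using p q by simp
    show "frequently (\<lambda>y. Q y \<le> of_rat p) F"
    proof (rule ccontr)
      assume "\<not> ?thesis"
      then have "eventually (\<lambda>y. ereal (of_rat p) \<le> ereal (Q y)) F"
        unfolding not_frequently by (rule eventually_mono) auto
      from Liminf_bounded[OF this] show False
        using a(1) p(1) by (metis ereal_less(1) less_ereal.simps(1) not_less order.strict_trans)
    qed
    show "frequently (\<lambda>y. Q y \<ge> of_rat q) F"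
    proof (rule ccontr)
      assume "\<not> ?thesis"
      then have "eventually (\<lambda>y. ereal (Q y) \<le> ereal (of_rat q)) F"
        unfolding not_frequently by (rule eventually_mono) auto
      from Limsup_bounded[OF this] show False
        using c(2) q(2) by (metis less_ereal.simps(1) not_less order.strict_trans)
    qed
  qed
qed

text \<open>
  A lower bound \<open>q\<close> on slopes of \<open>f\<close> is an upper bound \<open>1 - q\<close> on slopes of \<open>x \<mapsto> x - f x\<close>, so the
  covering bound applies to both functions. By \<open>lborel_split\<close> the intersection of the two
  covers has Lebesgue measure at most \<open>(p + (1 - q))\<close> times that of \<open>U\<close>.
\<close>

lemma negligible_slope_oscillation:
  fixes f :: "real \<Rightarrow> real"
  assumes f: "mono f" and g: "mono (\<lambda>x. x - f x)" and pq: "0 \<le> p" "p < q" "q \<le> 1"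
    and "bounded S"
    and low: "\<And>x. x \<in> S \<Longrightarrow> frequently (\<lambda>y. (f y - f x) / (y - x) \<le> p) (at x)"
    and high: "\<And>x. x \<in> S \<Longrightarrow> frequently (\<lambda>y. (f y - f x) / (y - x) \<ge> q) (at x)"
  shows "negligible S"
proof (rule negligible_if_covers_shrink[where c = "1 - (q - p)"])
  let ?g = "\<lambda>x. x - f x"
  have high': "frequently (\<lambda>y. (?g y - ?g x) / (y - x) \<le> 1 - q) (at x)" if "x \<in> S" for x
  proof -
    have "eventually (\<lambda>y. y \<noteq> x) (at x)"
      by (simp add: eventually_at_filter)
    from frequently_eventually_frequently[OF high[OF that] this] show ?thesis
    proof (rule frequently_elim1)
      fix y assume y: "q \<le> (f y - f x) / (y - x) \<and> y \<noteq> x"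
      then have "(?g y - ?g x) / (y - x) = 1 - (f y - f x) / (y - x)"
        by (simp add: field_simps)
      with y show "(?g y - ?g x) / (y - x) \<le> 1 - q" by simp
    qed
  qed
  fix U :: "real set" assume U: "open U" "S \<subseteq> U"
  obtain T1 where T1: "T1 \<in> sets borel" "S \<subseteq> T1"
    "emeasure (interval_measure f) T1 \<le> ennreal p * emeasure lborel U"
    using Vitali_slope_bound[OF f g U pq(1) low] by blast
  obtain T2 where T2: "T2 \<in> sets borel" "S \<subseteq> T2"
    "emeasure (interval_measure ?g) T2 \<le> ennreal (1 - q) * emeasure lborel U"
    using Vitali_slope_bound[OF g _ U _ high'] f pq by auto
  have "emeasure lborel (T1 \<inter> T2) =
      emeasure (interval_measure f) (T1 \<inter> T2) + emeasure (interval_measure ?g) (T1 \<inter> T2)"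
    using T1 T2 by (intro lborel_split[OF f g]) auto
  also have "\<dots> \<le> emeasure (interval_measure f) T1 + emeasure (interval_measure ?g) T2"
    using T1 T2 by (intro add_mono emeasure_mono) auto
  also have "\<dots> \<le> ennreal p * emeasure lborel U + ennreal (1 - q) * emeasure lborel U"
    using T1 T2 by (intro add_mono)
  also have "\<dots> = ennreal (1 - (q - p)) * emeasure lborel U"
  proof -
    have "ennreal p + ennreal (1 - q) = ennreal (p + (1 - q))"
      using pq by (intro ennreal_plus[symmetric]) auto
    also have "p + (1 - q) = 1 - (q - p)" by simp
    finally show ?thesis by (simp only: distrib_right[symmetric])
  qed
  finally show "\<exists>T\<in>sets borel. S \<subseteq> T \<and> emeasure lborel T \<le> ennreal (1 - (q - p)) * emeasure lborel U"
    using T1 T2 by (intro bexI[of _ "T1 \<inter> T2"]) auto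
qed (use pq \<open>bounded S\<close> in auto)

text \<open>
  The points of oscillation are the union of countably many null sets, one for each pair of rational
  levels and each bound on \<open>\<bar>x\<bar>\<close>.
\<close>

theorem nonexpansive_mono_differentiable_ae:
  fixes f :: "real \<Rightarrow> real"
  assumes f: "mono f" and g: "mono (\<lambda>x. x - f x)"
  shows "negligible {x. \<not> (\<exists>D. (f has_real_derivative D) (at x))}"
proof -
  let ?Q = "\<lambda>x y. (f y - f x) / (y - x)"
  have Q: "0 \<le> ?Q x y" "?Q x y \<le> 1" for x y
    using monoD[OF f, of x y] monoD[OF f, of y x] monoD[OF g, of x y] monoD[OF g, of y x]
    by (cases x y rule: linorder_cases; force simp: field_simps)+
  define S where "S p q n = {x. \<bar>x\<bar> \<le> real n \<and> frequently (\<lambda>y. ?Q x y \<le> of_rat p) (at x) \<and>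
      frequently (\<lambda>y. ?Q x y \<ge> of_rat q) (at x)}" for p q n
  have "negligible (S p q n)" if pq: "(of_rat p::real) < of_rat q" for p q n
  proof (cases "S p q n = {}")
    case False
    then obtain x where "frequently (\<lambda>y. ?Q x y \<le> of_rat p) (at x)"
        "frequently (\<lambda>y. ?Q x y \<ge> of_rat q) (at x)"
      by (auto simp: S_def)
    then have "0 \<le> (of_rat p::real)" "(of_rat q::real) \<le> 1"
      using Q frequently_ex order.trans by meson+
    moreover have "bounded (S p q n)"
      by (rule boundedI[of _ "real n"]) (auto simp: S_def)
    ultimately show ?thesis
      using pq by (intro negligible_slope_oscillation[OF f g, of "of_rat p" "of_rat q"])
        (auto simp: S_def)
  qed simp
  then have "negligible (\<Union>(p, q, n) \<in> {(p, q, n). (of_rat p::real) < of_rat q}. S p q n)"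
    by (intro negligible_countable_Union) auto
  moreover have "{x. \<not> (\<exists>D. (f has_real_derivative D) (at x))} \<subseteq>
      (\<Union>(p, q, n) \<in> {(p, q, n). (of_rat p::real) < of_rat q}. S p q n)"
  proof
    fix x assume "x \<in> {x. \<not> (\<exists>D. (f has_real_derivative D) (at x))}"
    then have nc: "\<not> (\<exists>D. (?Q x \<longlongrightarrow> D) (at x))"
      by (simp add: has_field_derivative_iff)
    obtain p q where pq: "(of_rat p::real) < of_rat q"
      "frequently (\<lambda>y. ?Q x y \<le> of_rat p) (at x)" "frequently (\<lambda>y. ?Q x y \<ge> of_rat q) (at x)"
      using slope_limit_or_oscillation[OF _ Q nc] by auto
    obtain n where "\<bar>x\<bar> \<le> real n"
      using real_arch_simple by blast
    with pq show "x \<in> (\<Union>(p, q, n) \<in> {(p, q, n). (of_rat p::real) < of_rat q}. S p q n)"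
      by (auto simp: S_def)
  qed
  ultimately show ?thesis
    using negligible_subset by blast
qed

section \<open>Differentiability in families with monotone increments\<close>

text \<open>
  If \<open>g - h\<close> and \<open>k - g\<close> are monotone, the difference quotients of \<open>g\<close> lie between those of \<open>h\<close> and
  those of \<open>k\<close>.
\<close>

lemma has_real_derivative_squeeze_increments:
  fixes g :: "real \<Rightarrow> real"
  assumes U: "open U" "x \<in> U"
    and squeeze: "\<And>\<epsilon>. 0 < \<epsilon> \<Longrightarrow> \<exists>h k A B.
      (h has_real_derivative A) (at x) \<and> (k has_real_derivative B) (at x) \<and> D - \<epsilon> < A \<and> B < D + \<epsilon> \<and>
      mono_on U (\<lambda>t. g t - h t) \<and> mono_on U (\<lambda>t. k t - g t)"
  shows "(g has_real_derivative D) (at x)"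
proof -
  let ?Q = "\<lambda>g t. (g t - g x) / (t - x) :: real"
  have le: "?Q h t \<le> ?Q k t" if "mono_on U (\<lambda>t. k t - h t)" "t \<in> U" "t \<noteq> x" for h k t
  proof -
    have "0 \<le> ((k t - h t) - (k x - h x)) / (t - x)"
    proof (cases "t < x")
      case True
      then show ?thesis
        using mono_onD[OF that(1) that(2) U(2)] by (intro divide_nonpos_nonpos) auto
    next
      case False
      then show ?thesis
        using mono_onD[OF that(1) U(2) that(2)] by (intro divide_nonneg_nonneg) auto
    qed
    also have "\<dots> = ?Q k t - ?Q h t"
      by (simp add: diff_divide_distrib)
    finally show ?thesis by simp
  qed
  have "(?Q g \<longlongrightarrow> D) (at x)"
  proof (rule tendstoI)
    fix \<epsilon> :: real assume "0 < \<epsilon>"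
    then obtain h k A B where hk: "(h has_real_derivative A) (at x)"
      "(k has_real_derivative B) (at x)" "D - \<epsilon> < A" "B < D + \<epsilon>"
      "mono_on U (\<lambda>t. g t - h t)" "mono_on U (\<lambda>t. k t - g t)"
      using squeeze by blast
    have "eventually (\<lambda>t. D - \<epsilon> < ?Q h t) (at x)" "eventually (\<lambda>t. ?Q k t < D + \<epsilon>) (at x)"
      using hk order_tendstoD unfolding has_field_derivative_iff by blast+
    moreover have "eventually (\<lambda>t. t \<in> U \<and> t \<noteq> x) (at x)"
      using U by (auto simp: eventually_at_filter eventually_nhds)
    ultimately show "eventually (\<lambda>t. dist (?Q g t) D < \<epsilon>) (at x)"
    proof eventually_elim
      case (elim t)
      then show ?case
        using le[OF hk(5), of t] le[OF hk(6), of t] by (simp add: dist_real_def)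
    qed
  qed
  then show ?thesis
    by (simp add: has_field_derivative_iff)
qed

text \<open>
  The derivatives at rational parameters increase with the parameter and extend to a monotone function \<open>\<phi>\<close> of
  real parameters. Where \<open>\<phi>\<close> is continuous, rational parameters on both sides have derivatives as
  close to \<open>\<phi> y\<close> as desired, and \<open>H y\<close> is squeezed between the corresponding members of the family.
\<close>

lemma countable_not_differentiable_monotone_family:
  fixes H :: "real \<Rightarrow> real \<Rightarrow> real"
  assumes U: "open U" "x \<in> U"
    and incr: "\<And>y z. 0 < y \<Longrightarrow> y \<le> z \<Longrightarrow> mono_on U (\<lambda>t. H z t - H y t)"
    and rat: "\<And>r. r \<in> \<rat> \<Longrightarrow> 0 < r \<Longrightarrow> \<exists>D. (H r has_real_derivative D) (at x)"
  shows "countable {y. 0 < y \<and> \<not> (\<exists>D. (H y has_real_derivative D) (at x))}"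
proof -
  obtain d where d: "(H r has_real_derivative d r) (at x)" if "r \<in> \<rat>" "0 < r" for r
    using rat by metis
  have d_mono: "d r \<le> d s" if "r \<in> \<rat>" "s \<in> \<rat>" "0 < r" "r \<le> s" for r s
  proof -
    have "((\<lambda>t. H s t - H r t) has_real_derivative d s - d r) (at x)"
      using that by (intro derivative_intros d) auto
    from mono_on_imp_deriv_nonneg[OF incr[of r s] this] show ?thesis
      using that U by (simp add: interior_open)
  qed
  let ?R = "\<lambda>y. {r \<in> \<rat>. 0 < r \<and> r \<le> (y::real)}"
  define \<phi> where "\<phi> y = Sup (d ` ?R y)" for y
  have bdd: "bdd_above (d ` ?R y)" for y
  proof -
    obtain s where "s \<in> \<rat>" "max 0 y < s"
      using Rats_dense_in_real[of "max 0 y" "max 0 y + 1"] by auto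
    then show ?thesis
      by (intro bdd_aboveI[of _ "d s"]) (auto intro!: d_mono)
  qed
  have ne: "?R y \<noteq> {}" if "0 < y" for y
    using Rats_dense_in_real[OF that] by (auto intro: less_imp_le)
  have "\<phi> y \<le> \<phi> z" if "0 < y" "y \<le> z" for y z
    unfolding \<phi>_def by (rule cSup_subset_mono) (use ne[OF that(1)] bdd that in auto)
  then have "mono_on {0<..} \<phi>"
    by (auto simp: mono_on_def)
  then have cnt: "countable {y \<in> {0<..}. \<not> isCont \<phi> y}"
    by (intro mono_on_ctble_discont_open) auto
  have "\<exists>D. (H y has_real_derivative D) (at x)" if y: "0 < y" "isCont \<phi> y" for y
  proof (rule exI[of _ "\<phi> y"], rule has_real_derivative_squeeze_increments[OF U])
    fix \<epsilon> :: real assume "0 < \<epsilon>"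
    then obtain \<delta> where \<delta>: "0 < \<delta>" "\<And>z. dist z y < \<delta> \<Longrightarrow> dist (\<phi> z) (\<phi> y) < \<epsilon>"
      using y(2) by (metis continuous_at_eps_delta)
    obtain a where a: "a \<in> \<rat>" "max 0 (y - \<delta>) < a" "a < y"
      using Rats_dense_in_real[of "max 0 (y - \<delta>)" y] y(1) \<delta>(1) by auto
    obtain b where b: "b \<in> \<rat>" "y < b" "b < y + \<delta>"
      using Rats_dense_in_real[of y "y + \<delta>"] \<delta>(1) by auto
    have \<phi>_rat: "\<phi> r = d r" if "r \<in> \<rat>" "0 < r" for r
      unfolding \<phi>_def by (rule cSup_eq_maximum) (use that in \<open>auto intro: d_mono\<close>)
    have "dist a y < \<delta>" "dist b y < \<delta>"
      using a b by (auto simp: dist_real_def)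
    from this[THEN \<delta>(2)] have "\<phi> y - \<epsilon> < d a" "d b < \<phi> y + \<epsilon>"
      using \<phi>_rat[of a] \<phi>_rat[of b] a b y(1) by (auto simp: dist_real_def)
    then show "\<exists>h k A B. (h has_real_derivative A) (at x) \<and> (k has_real_derivative B) (at x) \<and>
        \<phi> y - \<epsilon> < A \<and> B < \<phi> y + \<epsilon> \<and> mono_on U (\<lambda>t. H y t - h t) \<and> mono_on U (\<lambda>t. k t - H y t)"
      using a b y(1) d[of a] d[of b] incr[of a y] incr[of y b]
      by (intro exI[of _ "H a"] exI[of _ "H b"] exI[of _ "d a"] exI[of _ "d b"]) auto
  qed
  then have "{y. 0 < y \<and> \<not> (\<exists>D. (H y has_real_derivative D) (at x))} \<subseteq>
      {y \<in> {0<..}. \<not> isCont \<phi> y}"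
    by auto
  then show ?thesis
    using cnt by (rule countable_subset)
qed

section \<open>Partial derivatives of Pareto-Levy copulas\<close>

lemma enn2real_one_divide_ennreal: "0 < t \<Longrightarrow> enn2real (1 / ennreal t) = 1 / t"
  using divide_ennreal[of 1 t] by (simp add: ennreal_1[symmetric] del: ennreal_1)

text \<open>
  The reciprocal is differentiable on the positive axis and so maps null sets to null sets.
\<close>

lemma ae_reciprocal_notin_negligible:
  assumes "negligible N"
  shows "AE t\<in>{0<..} in lebesgue. 1 / t \<notin> (N :: real set)"
proof -
  have "negligible ((\<lambda>s. 1 / s) ` (N \<inter> {0<..}))"
    using assms
    by (intro negligible_differentiable_image_negligible)
       (auto intro!: derivative_intros intro: negligible_subset simp: differentiable_on_def)
  then have "(\<lambda>s. 1 / s) ` (N \<inter> {0<..}) \<in> null_sets lebesgue"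
    by (simp add: negligible_iff_null_sets)
  moreover have "{t \<in> space lebesgue. \<not> (t \<in> {0<..} \<longrightarrow> 1 / t \<notin> N)} \<subseteq> (\<lambda>s. 1 / s) ` (N \<inter> {0<..})"
    by (auto intro!: image_eqI[of _ _ "1 / _"])
  ultimately show ?thesis
    by (rule AE_I')
qed

text \<open>
  In the variable \<open>s = 1/t\<close> the margin becomes the identity, which turns \<open>G\<close> into a monotone function
  increasing no faster than \<open>s\<close>. Almost everywhere differentiability is transported
  back by the chain rule.
\<close>

lemma partial1_ae_exists:
  assumes G: "pareto_levy_copula G"
  shows "AE t\<in>{0<..} in lebesgue. partial1_exists G t v"
proof -
  \<comment> \<open>\<open>s = 0\<close> corresponds to \<open>t = \<infinity>\<close>, where \<open>G\<close> vanishes, so extending by \<open>0\<close> keeps \<open>f\<close> monotone\<close>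
  define f where "f s = (if s \<le> 0 then 0 else G (ennreal (1 / s), v))" for s
  have step: "0 \<le> f t - f s \<and> f t - f s \<le> t - s" if "s \<le> t" for s t
  proof -
    consider "t \<le> 0" | "s \<le> 0" "0 < t" | "0 < s" using that by linarith
    then show ?thesis
    proof cases
      case 2
      have "G (ennreal (1 / t), v) \<le> t" "0 \<le> G (ennreal (1 / t), v)"
        using 2 pl_copula_decrement_le[OF G, of "ennreal (1 / t)" \<infinity> v]
          pl_copula_antimono[OF G, of "ennreal (1 / t)" v \<infinity>] pl_copula_grounded[OF G]
        by (simp_all add: enn2real_one_divide_ennreal pl_dom_def)
      with 2 show ?thesis by (simp add: f_def)
    next
      case 3
      have le: "ennreal (1 / t) \<le> ennreal (1 / s)"
        using 3 that by (intro ennreal_leI) (simp add: frac_le)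
      show ?thesis
        using 3 that le pl_copula_decrement_le[OF G _ le, of v]
          pl_copula_antimono[OF G _ le, of v]
        by (simp add: f_def enn2real_one_divide_ennreal pl_dom_def)
    qed (use that in \<open>simp add: f_def\<close>)
  qed
  have "mono f" "mono (\<lambda>s. s - f s)"
    using step by (intro monoI; smt (verit))+
  then have "negligible {s. \<not> (\<exists>D. (f has_real_derivative D) (at s))}"
    by (rule nonexpansive_mono_differentiable_ae)
  then have "AE t\<in>{0<..} in lebesgue. 1 / t \<notin> {s. \<not> (\<exists>D. (f has_real_derivative D) (at s))}"
    by (rule ae_reciprocal_notin_negligible)
  then show ?thesis
  proof (rule eventually_mono, intro impI)
    fix t :: real
    assume "t \<in> {0<..} \<longrightarrow> 1 / t \<notin> {s. \<not> (\<exists>D. (f has_real_derivative D) (at s))}" "t \<in> {0<..}"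
    then obtain D where t: "0 < t" and D: "(f has_real_derivative D) (at (1 / t))"
      by auto
    have inv: "((\<lambda>s. 1 / s) has_real_derivative - (1 / t\<^sup>2)) (at t)"
      using t by (auto intro!: derivative_eq_intros simp: power2_eq_square)
    have "((\<lambda>s. f (1 / s)) has_real_derivative D * - (1 / t\<^sup>2)) (at t)"
      using DERIV_chain2[OF D inv] .
    then have "((\<lambda>s. G (ennreal s, v)) has_real_derivative D * - (1 / t\<^sup>2)) (at t)"
      by (rule has_field_derivative_transform_within_open[of _ _ _ "{0<..}"])
         (use t in \<open>auto simp: f_def\<close>)
    then show "partial1_exists G t v"
      unfolding partial1_exists_def has_partial1_def by blast
  qed
qed

lemma pl_copula_increment_mono:
  assumes G: "pareto_levy_copula G" and "a \<le> b"
  shows "mono_on {0<..} (\<lambda>t. G (ennreal t, b) - G (ennreal t, a))"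
proof (rule mono_onI)
  fix s t :: real assume "s \<in> {0<..}" "t \<in> {0<..}" "s \<le> t"
  then show "G (ennreal s, b) - G (ennreal s, a) \<le> G (ennreal t, b) - G (ennreal t, a)"
    using pl_copula_two_increasing[OF G, of "ennreal s" "ennreal t" a b] assms(2)
    by (simp add: pl_dom_def ennreal_leI)
qed

text \<open>
  These are the signs of the derivatives of the monotone functions \<open>t \<mapsto> - G(t, v)\<close> and
  \<open>t \<mapsto> G(t, v) - 1/t\<close>.
\<close>

lemma has_partial1_bounds:
  assumes G: "pareto_levy_copula G" and D: "has_partial1 G D t v" and t: "0 < t"
  shows "D \<le> 0" "- (1 / t\<^sup>2) \<le> D"
proof -
  have D': "((\<lambda>t. G (ennreal t, v)) has_real_derivative D) (at t)"
    using D by (simp add: has_partial1_def)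
  have t': "t \<in> interior {0<..}"
    using t by (simp add: interior_open)
  have "mono_on {0<..} (\<lambda>t. - G (ennreal t, v))"
    by (rule mono_onI) (auto intro!: pl_copula_antimono[OF G] ennreal_leI simp: pl_dom_def)
  from mono_on_imp_deriv_nonneg[OF this DERIV_minus[OF D'] t'] show "D \<le> 0" by simp
  have "mono_on {0<..} (\<lambda>t. G (ennreal t, v) - 1 / t)"
  proof (rule mono_onI)
    fix r s :: real assume "r \<in> {0<..}" "s \<in> {0<..}" "r \<le> s"
    then show "G (ennreal r, v) - 1 / r \<le> G (ennreal s, v) - 1 / s"
      using pl_copula_decrement_le[OF G, of "ennreal r" "ennreal s" v]
      by (simp add: ennreal_leI enn2real_one_divide_ennreal)
  qed
  moreover have "((\<lambda>t. G (ennreal t, v) - 1 / t) has_real_derivative D + 1 / t\<^sup>2) (at t)"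
    using t by (auto intro!: derivative_eq_intros D' simp: power2_eq_square)
  ultimately have "0 \<le> D + 1 / t\<^sup>2"
    using t' by (rule mono_on_imp_deriv_nonneg)
  then show "- (1 / t\<^sup>2) \<le> D" by simp
qed

lemma has_partial1_mono:
  assumes G: "pareto_levy_copula G" and t: "0 < t" and "a \<le> b"
    and D: "has_partial1 G D t a" and E: "has_partial1 G E t b"
  shows "D \<le> E"
proof -
  have "((\<lambda>t. G (ennreal t, b) - G (ennreal t, a)) has_real_derivative E - D) (at t)"
    using D E unfolding has_partial1_def by (intro DERIV_diff)
  moreover have "t \<in> interior {0<..}"
    using t by (simp add: interior_open)
  ultimately have "0 \<le> E - D"
    by (rule mono_on_imp_deriv_nonneg[OF pl_copula_increment_mono[OF G \<open>a \<le> b\<close>]])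
  then show ?thesis by simp
qed

lemma partial1_exists_imp_has_partial1:
  "partial1_exists G t v \<Longrightarrow> has_partial1 G (partial1 G t v) t v"
  unfolding partial1_exists_def using has_partial1_partial1 by blast

text \<open>
  Countably many null sets of \<open>u\<^sub>1\<close> are discarded, one for each rational \<open>u\<^sub>2\<close>; for every remaining
  \<open>u\<^sub>1\<close> the exceptional \<open>u\<^sub>2\<close> are countable in number.
\<close>

lemma partial1_ae_ae_exists:
  assumes G: "pareto_levy_copula G"
  shows "AE u1\<in>{0<..} in lebesgue. AE u2\<in>{0<..} in lebesgue. partial1_exists G u1 (ennreal u2)"
proof -
  have "AE u1 in lebesgue. \<forall>r\<in>\<rat>. u1 \<in> {0<..} \<longrightarrow> partial1_exists G u1 (ennreal r)"
    unfolding AE_ball_countable[OF countable_rat] using partial1_ae_exists[OF G] by blast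
  then show ?thesis
  proof (rule eventually_mono, intro impI)
    fix u1 :: real
    assume rat: "\<forall>r\<in>\<rat>. u1 \<in> {0<..} \<longrightarrow> partial1_exists G u1 (ennreal r)" and u1: "u1 \<in> {0<..}"
    let ?N = "{y. 0 < y \<and> \<not> partial1_exists G u1 (ennreal y)}"
    have "countable {y. 0 < y \<and>
        \<not> (\<exists>D. ((\<lambda>t. G (ennreal t, ennreal y)) has_real_derivative D) (at u1))}"
      by (rule countable_not_differentiable_monotone_family[of "{0<..}"])
         (use rat u1 in \<open>auto intro!: pl_copula_increment_mono[OF G] ennreal_leI
            simp: partial1_exists_def has_partial1_def\<close>)
    then have "?N \<in> null_sets lebesgue"
      unfolding partial1_exists_def has_partial1_def
      by (intro null_sets_completionI countable_imp_null_set_lborel)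
    then show "AE u2\<in>{0<..} in lebesgue. partial1_exists G u1 (ennreal u2)"
      by (rule AE_I') auto
  qed
qed

lemma has_partial1_axes:
  assumes G: "pareto_levy_copula G" and t: "0 < t"
  shows "has_partial1 G (- (1 / t\<^sup>2)) t 0" "has_partial1 G 0 t \<infinity>"
proof -
  have "((\<lambda>s. 1 / s) has_real_derivative - (1 / t\<^sup>2)) (at t)"
    using t by (auto intro!: derivative_eq_intros simp: power2_eq_square)
  then show "has_partial1 G (- (1 / t\<^sup>2)) t 0"
    unfolding has_partial1_def
    by (rule has_field_derivative_transform_within_open[of _ _ _ "{0<..}"])
       (use t in \<open>auto simp: pl_copula_margin[OF G] enn2real_one_divide_ennreal\<close>)
  show "has_partial1 G 0 t \<infinity>"
    using pl_copula_grounded(1)[OF G] by (simp add: has_partial1_def)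
qed

lemma pl_copula_partial1:
  assumes G: "pareto_levy_copula G"
  shows "(\<forall>u1>0. has_partial1 G (- (1 / u1\<^sup>2)) u1 0 \<and> has_partial1 G 0 u1 \<infinity>) \<and>
     (\<forall>u2>0. (AE u1\<in>{0<..} in lebesgue. partial1_exists G u1 (ennreal u2)) \<and>
             (\<forall>u1>0. partial1_exists G u1 (ennreal u2) \<longrightarrow>
                0 \<ge> partial1 G u1 (ennreal u2) \<and> partial1 G u1 (ennreal u2) \<ge> - (1 / u1\<^sup>2))) \<and>
     (AE u1\<in>{0<..} in lebesgue.
        (AE u2\<in>{0<..} in lebesgue. partial1_exists G u1 (ennreal u2)) \<and>
        mono_on {u2. 0 < u2 \<and> partial1_exists G u1 (ennreal u2)}
          (\<lambda>u2. partial1 G u1 (ennreal u2)))"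
proof (intro conjI allI impI)
  have mono: "mono_on {u2. 0 < u2 \<and> partial1_exists G u1 (ennreal u2)}
      (\<lambda>u2. partial1 G u1 (ennreal u2))" if "0 < u1" for u1
    using has_partial1_mono[OF G that ennreal_leI
        partial1_exists_imp_has_partial1 partial1_exists_imp_has_partial1]
    by (intro mono_onI) blast
  from partial1_ae_ae_exists[OF G]
  show "AE u1\<in>{0<..} in lebesgue.
      (AE u2\<in>{0<..} in lebesgue. partial1_exists G u1 (ennreal u2)) \<and>
      mono_on {u2. 0 < u2 \<and> partial1_exists G u1 (ennreal u2)}
        (\<lambda>u2. partial1 G u1 (ennreal u2))"
    by (rule eventually_mono) (use mono in auto)
qed (use has_partial1_axes[OF G] partial1_ae_exists[OF G]
      has_partial1_bounds[OF G partial1_exists_imp_has_partial1] in auto)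

lemma partial2_eq_partial1_swap:
  "has_partial2 G D u1 u2 = has_partial1 (G \<circ> prod.swap) D u2 u1"
  "partial2_exists G u1 u2 = partial1_exists (G \<circ> prod.swap) u2 u1"
  "partial2 G u1 u2 = partial1 (G \<circ> prod.swap) u2 u1"
  by (simp_all add: has_partial2_def has_partial1_def partial2_exists_def partial1_exists_def
    partial2_def partial1_def)

theorem proposition2p3:
  fixes G :: "ennreal \<times> ennreal \<Rightarrow> real"
  assumes "pareto_levy_copula G"
  shows
    \<comment> \<open>(i)\<close>
    "(\<forall>u\<in>pl_dom. \<forall>v\<in>pl_dom.
        ennreal \<bar>G u - G v\<bar> \<le>
          ennreal_dist (1 / fst u) (1 / fst v) + ennreal_dist (1 / snd u) (1 / snd v)) \<and>
     \<comment> \<open>(ii)\<close>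
     two_increasing G \<and>
     (\<forall>u. antimono_on {v. (u, v) \<in> pl_dom} (\<lambda>v. G (u, v))) \<and>
     (\<forall>u. antimono_on {v. (v, u) \<in> pl_dom} (\<lambda>v. G (v, u))) \<and>
     \<comment> \<open>(iii)\<close>
     (\<forall>u\<in>pl_dom. pl_copula_indep u \<le> G u \<and> G u \<le> pl_copula_dep u) \<and>
     \<comment> \<open>(iv), first argument\<close>
     (\<forall>u1>0. has_partial1 G (- (1 / u1\<^sup>2)) u1 0 \<and> has_partial1 G 0 u1 \<infinity>) \<and>
     (\<forall>u2>0. (AE u1\<in>{0<..} in lebesgue. partial1_exists G u1 (ennreal u2)) \<and>
             (\<forall>u1>0. partial1_exists G u1 (ennreal u2) \<longrightarrow>
                0 \<ge> partial1 G u1 (ennreal u2) \<and> partial1 G u1 (ennreal u2) \<ge> - (1 / u1\<^sup>2))) \<and>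
     (AE u1\<in>{0<..} in lebesgue.
        (AE u2\<in>{0<..} in lebesgue. partial1_exists G u1 (ennreal u2)) \<and>
        mono_on {u2. 0 < u2 \<and> partial1_exists G u1 (ennreal u2)}
          (\<lambda>u2. partial1 G u1 (ennreal u2))) \<and>
     \<comment> \<open>(iv), second argument\<close>
     (\<forall>u2>0. has_partial2 G (- (1 / u2\<^sup>2)) 0 u2 \<and> has_partial2 G 0 \<infinity> u2) \<and>
     (\<forall>u1>0. (AE u2\<in>{0<..} in lebesgue. partial2_exists G (ennreal u1) u2) \<and>
             (\<forall>u2>0. partial2_exists G (ennreal u1) u2 \<longrightarrow>
                0 \<ge> partial2 G (ennreal u1) u2 \<and> partial2 G (ennreal u1) u2 \<ge> - (1 / u2\<^sup>2))) \<and>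
     (AE u2\<in>{0<..} in lebesgue.
        (AE u1\<in>{0<..} in lebesgue. partial2_exists G (ennreal u1) u2) \<and>
        mono_on {u1. 0 < u1 \<and> partial2_exists G (ennreal u1) u2}
          (\<lambda>u1. partial2 G (ennreal u1) u2))"
proof -
  have swap: "pareto_levy_copula (G \<circ> prod.swap)"
    using assms by (rule pl_copula_swap)
  have lip: "\<forall>u\<in>pl_dom. \<forall>v\<in>pl_dom. ennreal \<bar>G u - G v\<bar> \<le>
      ennreal_dist (1 / fst u) (1 / fst v) + ennreal_dist (1 / snd u) (1 / snd v)"
    using pl_copula_lipschitz[OF assms] by blast
  have two: "two_increasing G"
    using assms by (simp add: pareto_levy_copula_def)
  have anti1: "\<forall>u. antimono_on {v. (v, u) \<in> pl_dom} (\<lambda>v. G (v, u))"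
    using pl_copula_antimono[OF assms] by (auto simp: monotone_on_def)
  have anti2: "\<forall>u. antimono_on {v. (u, v) \<in> pl_dom} (\<lambda>v. G (u, v))"
    using pl_copula_antimono[OF swap] by (auto simp: monotone_on_def pl_dom_def)
  have bounds: "\<forall>u\<in>pl_dom. pl_copula_indep u \<le> G u \<and> G u \<le> pl_copula_dep u"
    using pl_copula_indep_le[OF assms] pl_copula_le_dep[OF assms] by blast
  show ?thesis
    unfolding partial2_eq_partial1_swap
    using lip two anti1 anti2 bounds pl_copula_partial1[OF assms] pl_copula_partial1[OF swap]
    by (elim conjE) (intro conjI; assumption)
qed

end
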